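(* Let $m,n\ge 1$ be integers, $r=2^m$, $s=2^n$, and $k=\gcd(m,n)$. For every $d\in\mathbb{F}_{r^2}\setminus\mathbb{F}_r$ there exists $c\in\mathbb{F}_{r^2}$ such that, for the function $F:\mathbb{F}_{r^2}\to\mathbb{F}_{r^2}$ given by $$F(x)=x\left(x^s+x^r+c\,x^{rs}\right)+x^s\left(c^r x^r+d\,x^{rs}\right)+x^{(s+1)r},$$ all the nonzero derivatives of $F$ are $2^k$-to-one mappings from $\mathbb{F}_{r^2}$ to $\mathbb{F}_{r^2}$; that is, for every nonzero $a\in\mathbb{F}_{r^2}$ and every $b\in\mathbb{F}_{r^2}$, the equation $F(x+a)+F(x)=b$ has either exactly $0$ or exactly $2^k$ solutions $x\in\mathbb{F}_{r^2}$.
   Context: $\mathbb{F}_q$ denotes the finite field with $q$ elements, and $\mathbb{F}_r$ is regarded as a subfield of $\mathbb{F}_{r^2}$. The nonzero derivatives of $F$ are the functions $x\mapsto F(x+a)+F(x)$ with $a\in\mathbb{F}_{r^2}$ nonzero. A map is $N$-to-one if every element of its target has either exactly $0$ or exactly $N$ preimages. *)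

theory Defs
  imports
    "HOL-Computational_Algebra.Primes"
    "HOL-Algebra.Algebraic_Closure_Type"
    "HOL-Library.Cardinality"
begin

definition F :: "nat \<Rightarrow> nat \<Rightarrow> 'a \<Rightarrow> 'a \<Rightarrow> 'a \<Rightarrow> 'a::field" where
  "F r s c d x =
     x * (x ^ s + x ^ r + c * x ^ (r * s))
     + x ^ s * (c ^ r * x ^ r + d * x ^ (r * s))
     + x ^ ((s + 1) * r)"

text \<open>The derivative is written with a plus sign, as is usual in characteristic two,
  where addition and subtraction coincide.\<close>

definition derivative_at :: "('a \<Rightarrow> 'a) \<Rightarrow> 'a \<Rightarrow> 'a \<Rightarrow> 'a::field" where
  "derivative_at f a x = f (x + a) + f x"

text \<open>The first disjunct is stated as emptiness rather than cardinality zero because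
  \<^const>\<open>card\<close> is also zero on infinite sets.\<close>

definition N_to_one :: "nat \<Rightarrow> ('a \<Rightarrow> 'b) \<Rightarrow> bool" where
  "N_to_one N f \<longleftrightarrow>
     (\<forall>b. {x. f x = b} = {} \<or> (finite {x. f x = b} \<and> card {x. f x = b} = N))"

end

theory Submission
  imports Defs "HOL-Number_Theory.Residues"
begin

text \<open>In the basis \<open>1, d\<close> over the subfield, \<open>F\<close> has the coordinates \<open>N + G\<close> and \<open>N\<^sup>s\<close>, where
  \<open>N x = x\<^sup>r\<^sup>+\<^sup>1\<close> and \<open>G x\<close> is the trace of \<open>x\<^sup>s\<^sup>+\<^sup>1 + c x x\<^sup>r\<^sup>s\<close>. The polar form of
  \<open>N\<close> at \<open>a\<close> vanishes exactly on \<open>a t\<close> with \<open>t\<close> in the subfield, where that of \<open>G\<close> is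
  \<open>G a (t + t\<^sup>s)\<close>. So if \<open>G\<close> has no nontrivial zero, the derivatives have a kernel with \<open>2\<^sup>k\<close>
  elements; if \<open>m\<close> divides \<open>n\<close>, then \<open>t + t\<^sup>s = 0\<close> always and \<open>G\<close> is irrelevant.

  Otherwise, with \<open>u = a\<^sup>r\<^sup>-\<^sup>1\<close>, a zero \<open>a\<close> of \<open>G\<close> gives a root \<open>u\<close> of
  \<open>u\<^sup>s\<^sup>+\<^sup>1 + c u\<^sup>s + c\<^sup>r u + 1\<close> among the \<open>r + 1\<close>
  elements with \<open>u\<^sup>r\<^sup>+\<^sup>1 = 1\<close>. For fixed \<open>u\<close> the \<open>c\<close> with this root form an affine line over the
  subfield. These \<open>r + 1\<close> lines do not cover the plane: many pairs of them intersect, while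
  reducing \<open>n\<close> modulo \<open>m\<close> shows that no point lies on more than \<open>r / 2 + 1\<close> lines.\<close>

section \<open>Roots of unity and Frobenius fixed points in finite fields\<close>

lemma card_power_eq_le:
  fixes y :: "'a::{comm_ring_1,ring_no_zero_divisors}"
  assumes "e > 0"
  shows "card {x. x ^ e = y} \<le> e"
proof -
  define p where "p = Polynomial.monom 1 e - [:y:]"
  have deg: "Polynomial.degree p = e"
    unfolding p_def using assms
    by (subst diff_conv_add_uminus, subst degree_add_eq_left) (auto simp: Polynomial.degree_monom_eq)
  then have "p \<noteq> 0"
    using assms by auto
  moreover have "{x. x ^ e = y} = {x. poly p x = 0}"
    by (simp add: p_def poly_monom)
  ultimately show ?thesis
    using card_poly_roots_bound[of p] deg by simp
qed

text \<open>With \<open>e * f = CARD('a) - 1\<close>, the \<open>f\<close>-th power maps the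
  \<open>e * f\<close> nonzero elements into the \<open>e\<close>-th roots of unity, with fibres of
  size at most \<open>f\<close>; so there are at least \<open>e\<close> such roots. The degree gives
  the upper bound.\<close>

lemma card_roots_of_unity_finite_field:
  assumes "e dvd CARD('a::finite_field) - 1"
  shows "card {x::'a. x ^ e = 1} = e"
proof -
  obtain f where f: "CARD('a) - 1 = e * f"
    using assms by (auto elim: dvdE)
  have "card {0::'a, 1} \<le> CARD('a)"
    by (intro card_mono) auto
  then have card: "CARD('a) \<ge> 2"
    by simp
  then have pos: "e > 0" "f > 0"
    using f card by (auto intro!: gr0I)
  have unity: "(x ^ f) ^ e = 1" if "x \<noteq> 0" for x :: 'a
  proof -
    have "x * (x ^ f) ^ e = x ^ Suc (f * e)"
      by (simp add: power_mult)
    also have "Suc (f * e) = CARD('a)"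
      using f card by (simp add: mult.commute)
    finally show ?thesis
      using that by (simp add: finite_field_power_card_eq_same)
  qed
  have "UNIV - {0} \<subseteq> (\<Union>y\<in>{x::'a. x ^ e = 1}. {x. x ^ f = y})"
    using unity by auto
  then have "card (UNIV - {0::'a}) \<le> card (\<Union>y\<in>{x::'a. x ^ e = 1}. {x. x ^ f = y})"
    by (intro card_mono) auto
  also have "\<dots> \<le> (\<Sum>y\<in>{x::'a. x ^ e = 1}. card {x. x ^ f = y})"
    by (rule card_UN_le) simp
  also have "\<dots> \<le> (\<Sum>y\<in>{x::'a. x ^ e = 1}. f)"
    by (intro sum_mono card_power_eq_le pos)
  finally have "e * f \<le> card {x::'a. x ^ e = 1} * f"
    using f by (simp add: card_Diff_singleton)
  then have "e \<le> card {x::'a. x ^ e = 1}"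
    using pos by simp
  with card_power_eq_le[OF pos(1), of "1::'a"] show ?thesis
    by simp
qed

lemma CHAR_eq_2I:
  assumes "CARD('a::finite_field) = 2 ^ l"
  shows "CHAR('a) = 2"
proof -
  have "CHAR('a) dvd 2 ^ l"
    using CHAR_dvd_CARD[where ?'a = 'a] assms by simp
  then have "CHAR('a) dvd 2"
    by (rule prime_dvd_power[rotated]) simp
  then show ?thesis
    using primes_dvd_imp_eq[of "CHAR('a)" 2] by simp
qed

lemma power_two_power_add:
  fixes x y :: "'a::finite_field"
  assumes "CHAR('a) = 2"
  shows "(x + y) ^ 2 ^ i = x ^ 2 ^ i + y ^ 2 ^ i"
  by (rule freshmans_dream') (use assms in auto)

lemma add_self_CHAR_2:
  fixes x y :: "'a::finite_field"
  assumes "CHAR('a) = 2"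
  shows "x + x = 0" "x + (x + y) = y"
  using minus_CHAR_2[OF assms, of x x] by (simp_all flip: add.assoc)

lemma add_eq_0_iff_CHAR_2:
  fixes x y :: "'a::finite_field"
  assumes "CHAR('a) = 2"
  shows "x + y = 0 \<longleftrightarrow> x = y"
  using minus_CHAR_2[OF assms, of x y] by (metis right_minus_eq)

lemma power_power_fixed:
  fixes x :: "'a::monoid_mult"
  assumes "x ^ q = x"
  shows "x ^ q ^ j = x"
  using assms by (induction j) (simp_all add: power_mult)

lemma two_power_minus_1_dvd:
  fixes k l :: nat
  assumes "k dvd l"
  shows "2 ^ k - 1 dvd (2 ^ l - 1 :: nat)"
proof -
  obtain q where q: "l = k * q"
    using assms by (auto elim: dvdE)
  have "[(2 ^ k) ^ q = 1 ^ q] (mod (2 ^ k - 1 :: nat))"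
    by (intro cong_pow) (simp add: cong_altdef_nat)
  then show ?thesis
    by (simp add: q power_mult cong_altdef_nat)
qed

lemma card_power_two_power_fixed:
  assumes "CARD('a::finite_field) = 2 ^ l" "k dvd l" "k > 0"
  shows "card {x::'a. x ^ 2 ^ k = x} = 2 ^ k"
proof -
  have ex: "(2::nat) ^ k = Suc (2 ^ k - 1)"
    by simp
  have "1 < (2::nat) ^ k"
    using assms(3) by (intro one_less_power) simp_all
  have "x ^ 2 ^ k = x \<longleftrightarrow> x = 0 \<or> x ^ (2 ^ k - 1) = 1" for x :: 'a
    by (subst ex, subst power_Suc) auto
  then have "{x::'a. x ^ 2 ^ k = x} = insert 0 {x. x ^ (2 ^ k - 1) = 1}"
    by blast
  moreover have "card {x::'a. x ^ (2 ^ k - 1) = 1} = 2 ^ k - 1"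
    by (rule card_roots_of_unity_finite_field)
       (use two_power_minus_1_dvd[OF assms(2)] in \<open>simp add: assms(1)\<close>)
  ultimately show ?thesis
    using \<open>1 < 2 ^ k\<close> by (simp add: power_0_left card_insert_if)
qed

text \<open>Bezout on Frobenius exponents: \<open>m * i = n * j + gcd m n\<close>, and the powers
  \<open>2 ^ (m * i)\<close> and \<open>2 ^ (n * j)\<close> both fix \<open>x\<close>.\<close>

lemma power_two_power_fixed_gcd:
  fixes x :: "'a::monoid_mult"
  assumes "m > 0"
  shows "x ^ 2 ^ m = x \<and> x ^ 2 ^ n = x \<longleftrightarrow> x ^ 2 ^ gcd m n = x"
proof safe
  assume x: "x ^ 2 ^ m = x" "x ^ 2 ^ n = x"
  obtain i j where ij: "m * i = n * j + gcd m n"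
    using bezout_nat[of m n] assms by auto
  have "x ^ 2 ^ (m * i) = x" "x ^ 2 ^ (n * j) = x"
    using power_power_fixed x by (metis power_mult)+
  then show "x ^ 2 ^ gcd m n = x"
    by (simp add: ij power_add power_mult)
next
  assume x: "x ^ 2 ^ gcd m n = x"
  have "x ^ 2 ^ (gcd m n * i) = x" for i
    using power_power_fixed[OF x] by (metis power_mult)
  then show "x ^ 2 ^ m = x" "x ^ 2 ^ n = x"
    by (metis dvd_mult_div_cancel gcd_dvd1 gcd_dvd2)+
qed

text \<open>Used to turn \<open>d \<notin> K\<close> into \<open>d ^ r \<noteq> d\<close>.
  Multiplication by a nonzero \<open>x\<close> in \<open>K\<close> permutes \<open>K - {0}\<close>,
  and comparing products gives \<open>x ^ (card K - 1) = 1\<close>; the degree leaves no room for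
  further fixed elements.\<close>

lemma subfield_eq_power_card_fixed:
  fixes K :: "'a::finite_field set"
  assumes "subfield K (ring_of_type_algebra :: 'a ring)"
  shows "K = {x. x ^ card K = x}"
proof -
  interpret R: ring "ring_of_type_algebra :: 'a ring"
    by (rule ring_from_type_algebra)
  have sub: "subring K (ring_of_type_algebra :: 'a ring)"
    by (rule subfieldE(1)[OF assms])
  have closed: "x * y \<in> K" if "x \<in> K" "y \<in> K" for x y
    using subringE(6)[OF sub that] by (simp add: ring_of_type_algebra_def)
  have zero_one: "0 \<in> K" "1 \<in> K"
    using subringE(2,3)[OF sub] by (simp_all add: ring_of_type_algebra_def)
  have "card {0::'a, 1} \<le> card K"
    using zero_one by (intro card_mono) auto
  then have card: "card K \<ge> 2"
    by simp
  have fixed: "x ^ card K = x" if "x \<in> K" for x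
  proof (cases "x = 0")
    case False
    have "inj_on ((*) x) (K - {0})"
      using False by (auto simp: inj_on_def)
    moreover have "(*) x ` (K - {0}) \<subseteq> K - {0}"
      using closed that False by auto
    ultimately have "(*) x ` (K - {0}) = K - {0}"
      by (intro endo_inj_surj) simp_all
    with \<open>inj_on ((*) x) (K - {0})\<close> have "\<Prod>(K - {0}) = (\<Prod>y\<in>K - {0}. x * y)"
      by (metis (no_types, lifting) prod.reindex_cong)
    also have "\<dots> = x ^ (card K - 1) * \<Prod>(K - {0})"
      using zero_one by (simp add: prod.distrib)
    finally have "x ^ (card K - 1) = 1"
      by simp
    then have "x ^ Suc (card K - 1) = x"
      by simp
    then show ?thesis
      using card by simp
  qed (use card zero_one in \<open>auto simp: power_0_left\<close>)
  define p where "p = Polynomial.monom (1::'a) (card K) - Polynomial.monom 1 1"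
  have deg: "Polynomial.degree p = card K"
    unfolding p_def using card
    by (subst diff_conv_add_uminus, subst degree_add_eq_left) (auto simp: Polynomial.degree_monom_eq)
  have "p \<noteq> 0"
    using deg card by auto
  then have "card {x::'a. x ^ card K = x} \<le> card K"
    using card_poly_roots_bound[of p] deg by (simp add: p_def poly_monom)
  then show ?thesis
    using fixed by (intro card_seteq) auto
qed

section \<open>Powers on the group of elements with \<open>u ^ (r + 1) = 1\<close>\<close>

lemma power_alternating_unity:
  fixes u :: "'a::comm_monoid_mult"
  assumes "u ^ (r + 1) = 1"
  shows "if even q then u ^ r ^ q = u else u * u ^ r ^ q = 1"
proof (induction q)
  case (Suc q)
  have r: "u * u ^ r = 1"
    using assms by simp
  have pow: "u ^ (r * r ^ q) = (u ^ r ^ q) ^ r"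
    by (metis mult.commute power_mult)
  show ?case
  proof (cases "even q")
    case True
    then show ?thesis
      using Suc r by (simp add: pow)
  next
    case False
    then have "u * u ^ r ^ q = 1"
      using Suc by simp
    then have "u ^ r * (u ^ r ^ q) ^ r = 1"
      by (metis power_mult_distrib power_one)
    then have "u * u ^ r * (u ^ r ^ q) ^ r = u"
      by (simp add: mult.assoc)
    then show ?thesis
      using False r by (simp add: pow)
  qed
qed simp

text \<open>The power \<open>2 ^ m\<close> inverts \<open>u\<close>, so up to inversion, decided by
  the parity of \<open>n div m\<close>, the exponent \<open>2 ^ n\<close> reduces to
  \<open>t\<close>. This keeps degrees low in the later root counts.\<close>

lemma power_two_power_unity:
  fixes u :: "'a::comm_monoid_mult" and m n :: nat
  assumes "u ^ (2 ^ m + 1) = 1"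
  defines "t \<equiv> 2 ^ (n mod m)"
  shows "if even (n div m) then u ^ 2 ^ n = u ^ t else u ^ t * u ^ 2 ^ n = 1"
proof -
  define q where "q = n div m"
  have "n = m * q + n mod m"
    by (simp add: q_def)
  then have pow: "u ^ 2 ^ n = (u ^ (2 ^ m) ^ q) ^ t"
    by (metis power_add power_mult t_def)
  have "if even q then u ^ (2 ^ m) ^ q = u else u * u ^ (2 ^ m) ^ q = 1"
    by (rule power_alternating_unity) fact
  then show ?thesis
    unfolding q_def[symmetric] pow by (metis power_mult_distrib power_one)
qed

section \<open>Root counting and the choice of \<open>c\<close>\<close>

lemma card_zeros_le:
  fixes p :: "'a::{comm_ring_1,ring_no_zero_divisors} poly"
  assumes "\<And>x. x \<in> A \<Longrightarrow> poly p x = 0" "Polynomial.coeff p i \<noteq> 0" "Polynomial.degree p \<le> d"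
  shows "card A \<le> d"
proof -
  have "p \<noteq> 0"
    using assms(2) by auto
  then have "card A \<le> card {x. poly p x = 0}"
    using assms(1) poly_roots_finite[of p] by (intro card_mono) auto
  also have "\<dots> \<le> Polynomial.degree p"
    by (rule card_poly_roots_bound) fact
  finally show ?thesis
    using assms(3) by simp
qed

text \<open>Second moment: if the sets covered everything, the multiplicities \<open>N c\<close> would satisfy
  \<open>\<Sum>(N c - 1) \<le> r\<close> and \<open>2 N c \<le> r + 2\<close>, leaving room for at most \<open>r (r + 2)\<close>
  incidences \<open>2 \<Sum>N c (N c - 1)\<close>, whereas at least \<open>(r + 1)\<^sup>2\<close> are required.\<close>
lemma not_covered_by_sets:
  fixes L :: "'b \<Rightarrow> 'a::finite set"
  assumes "finite M" and card_M: "card M = r + 1" and card_UNIV: "CARD('a) = r ^ 2"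
    and card_L: "\<And>u. u \<in> M \<Longrightarrow> card (L u) \<le> r"
    and mult: "\<And>c. 2 * card {u \<in> M. c \<in> L u} \<le> r + 2"
    and meet: "\<And>u. u \<in> M \<Longrightarrow> 2 * card {v \<in> M. v \<noteq> u \<and> L u \<inter> L v \<noteq> {}} \<ge> r + 1"
  obtains c where "\<And>u. u \<in> M \<Longrightarrow> c \<notin> L u"
proof -
  define N where "N c = card {u \<in> M. c \<in> L u}" for c
  have N_sum: "N c = (\<Sum>u\<in>M. of_bool (c \<in> L u))" for c
    using \<open>finite M\<close> by (simp add: N_def of_bool_def sum.If_cases Int_def)
  have card_sum: "card A = (\<Sum>c\<in>UNIV. of_bool (c \<in> A))" for A :: "'a set"
    by (simp add: of_bool_def sum.If_cases)
  have "\<exists>c. N c = 0"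
  proof (rule ccontr)
    assume "\<not> ?thesis"
    then have pos: "N c \<ge> 1" for c
      by (simp add: Suc_leI)
    have first: "(\<Sum>c\<in>UNIV. N c) = (\<Sum>u\<in>M. card (L u))"
      unfolding N_sum card_sum by (rule sum.swap)
    also have "\<dots> \<le> (\<Sum>u\<in>M. r)"
      by (intro sum_mono card_L)
    finally have first_le: "(\<Sum>c\<in>UNIV. N c) \<le> (r + 1) * r"
      using card_M by simp
    have "(\<Sum>c\<in>UNIV. N c * N c) = (\<Sum>c\<in>UNIV. \<Sum>u\<in>M. \<Sum>v\<in>M. of_bool (c \<in> L u \<inter> L v))"
      by (simp add: N_sum sum_product flip: of_bool_conj)
    also have "\<dots> = (\<Sum>u\<in>M. \<Sum>c\<in>UNIV. \<Sum>v\<in>M. of_bool (c \<in> L u \<inter> L v))"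
      by (rule sum.swap)
    also have "\<dots> = (\<Sum>u\<in>M. \<Sum>v\<in>M. card (L u \<inter> L v))"
      unfolding card_sum by (intro sum.cong sum.swap refl)
    finally have second: "(\<Sum>c\<in>UNIV. N c * N c) = (\<Sum>u\<in>M. \<Sum>v\<in>M. card (L u \<inter> L v))" .
    \<comment> \<open>The term \<open>v = u\<close> contributes \<open>card (L u)\<close>; every
      other \<open>v\<close> whose set meets \<open>L u\<close> contributes at least 1.\<close>
    have row: "2 * card (L u) + (r + 1) \<le> 2 * (\<Sum>v\<in>M. card (L u \<inter> L v))" if u: "u \<in> M" for u
    proof -
      let ?A = "{v \<in> M. v \<noteq> u \<and> L u \<inter> L v \<noteq> {}}"
      have "(\<Sum>v\<in>M. card (L u \<inter> L v)) = card (L u) + (\<Sum>v\<in>M - {u}. card (L u \<inter> L v))"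
        using \<open>finite M\<close> u by (simp add: sum.remove)
      moreover have "(\<Sum>v\<in>?A. 1) \<le> (\<Sum>v\<in>?A. card (L u \<inter> L v))"
        by (intro sum_mono) (simp add: Suc_leI card_gt_0_iff)
      moreover have "(\<Sum>v\<in>?A. card (L u \<inter> L v)) \<le> (\<Sum>v\<in>M - {u}. card (L u \<inter> L v))"
        using \<open>finite M\<close> by (intro sum_mono2) auto
      ultimately show ?thesis
        using meet[OF u] by simp
    qed
    have "(\<Sum>u\<in>M. 2 * card (L u) + (r + 1)) \<le> (\<Sum>u\<in>M. 2 * (\<Sum>v\<in>M. card (L u \<inter> L v)))"
      by (intro sum_mono row)
    moreover have "(\<Sum>u\<in>M. 2 * card (L u) + (r + 1)) = 2 * (\<Sum>u\<in>M. card (L u)) + (r + 1) * (r + 1)"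
      by (simp only: sum.distrib sum_constant card_M flip: sum_distrib_left) simp
    ultimately have lower: "2 * (\<Sum>c\<in>UNIV. N c) + (r + 1) * (r + 1) \<le> 2 * (\<Sum>c\<in>UNIV. N c * N c)"
      by (simp add: first second sum_distrib_left)
    \<comment> \<open>This is \<open>(N c - 1) * (r + 2 - 2 * N c) \<ge> 0\<close>, rearranged to
      avoid subtraction.\<close>
    have "2 * (N c * N c) + (r + 2) \<le> 2 * N c + (r + 2) * N c" for c
    proof -
      obtain e where e: "N c = Suc e"
        using pos[of c] by (cases "N c") auto
      have "2 * N c * e \<le> (r + 2) * e"
        using mult[of c] by (intro mult_le_mono1) (simp add: N_def)
      then show ?thesis
        by (simp add: e algebra_simps)
    qed
    then have "(\<Sum>c\<in>(UNIV::'a set). 2 * (N c * N c) + (r + 2)) \<le> (\<Sum>c\<in>UNIV. 2 * N c + (r + 2) * N c)"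
      by (intro sum_mono)
    then have "2 * (\<Sum>c\<in>UNIV. N c * N c) + r ^ 2 * (r + 2)
        \<le> 2 * (\<Sum>c\<in>UNIV. N c) + (r + 2) * (\<Sum>c\<in>UNIV. N c)"
      by (simp only: sum.distrib sum_constant card_UNIV flip: sum_distrib_left) simp
    moreover have "(r + 2) * (\<Sum>c\<in>UNIV. N c) \<le> (r + 2) * ((r + 1) * r)"
      by (intro mult_le_mono2 first_le)
    \<comment> \<open>The left side exceeds the right side by exactly 1.\<close>
    ultimately have "(r + 1) * (r + 1) + r ^ 2 * (r + 2) \<le> (r + 2) * ((r + 1) * r)"
      using lower by linarith
    then show False
      by (simp add: algebra_simps power2_eq_square)
  qed
  then show ?thesis
    using that \<open>finite M\<close> by (auto simp: N_def)
qed

text \<open>An instance of \<open>not_covered_by_sets\<close>: \<open>M\<close> is the group of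
  order \<open>r + 1\<close>, and \<open>L u\<close> collects the \<open>c\<close> for which
  \<open>u\<close> is a root.\<close>

lemma ex_no_unity_root:
  fixes m n r s :: nat
  assumes r_def: "r = 2 ^ m" and s_def: "s = 2 ^ n"
    and card: "CARD('a::finite_field) = r ^ 2" and ndvd: "\<not> m dvd n"
  obtains c :: "'a::finite_field" where "\<And>u. u ^ (r + 1) = 1 \<Longrightarrow> u ^ (s + 1) + c * u ^ s + c ^ r * u + 1 \<noteq> 0"
proof -
  have char: "CHAR('a) = 2"
    by (rule CHAR_eq_2I[of "m * 2"]) (simp add: card r_def power_mult)
  note two = add_self_CHAR_2[OF char]
  have addr: "(x + y) ^ r = x ^ r + y ^ r" for x y :: 'a
    unfolding r_def by (rule power_two_power_add[OF char])
  have "m > 0"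
    using card r_def ndvd card_mono[of UNIV "{0::'a, 1}"] by (cases m) auto
  have "r ^ 2 - 1 = (r + 1) * (r - 1)"
    by (cases r) (simp_all add: power2_eq_square algebra_simps)
  then have dvd: "r + 1 dvd CARD('a) - 1"
    unfolding card by (metis dvd_triv_left)
  define M where "M = {u::'a. u ^ (r + 1) = 1}"
  have card_M: "card M = r + 1"
    unfolding M_def by (rule card_roots_of_unity_finite_field[OF dvd])
  define t :: nat where "t = 2 ^ (n mod m)"
  \<comment> \<open>The remainder is nonzero by \<open>ndvd\<close>, hence
    \<open>2 \<le> t \<le> r / 2\<close>; the bound of \<open>t + 1\<close> roots below then yields
    \<open>r / 2 + 1\<close>.\<close>
  have "n mod m > 0" "n mod m < m"
    using ndvd \<open>m > 0\<close> by (auto simp: dvd_eq_mod_eq_0)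
  then have "2 ^ 1 \<le> t" "2 ^ Suc (n mod m) \<le> r"
    unfolding t_def r_def by (intro power_increasing; simp)+
  then have t: "t \<ge> 2" "2 * t \<le> r"
    by (simp_all add: t_def)
  have pow_s: "if even (n div m) then u ^ s = u ^ t else u ^ t * u ^ s = 1" if "u \<in> M" for u
    using that unfolding s_def t_def M_def r_def mem_Collect_eq by (rule power_two_power_unity)
  define L where "L u = {c::'a. u ^ (s + 1) + c * u ^ s + c ^ r * u + 1 = 0}" for u
  have unity: "u \<noteq> 0" "u ^ r = inverse u" if "u \<in> M" for u
  proof -
    have *: "u * u ^ r = 1"
      using that by (simp add: M_def)
    then show "u \<noteq> 0"
      by auto
    then show "u ^ r = inverse u"
      using * by (simp add: field_simps)
  qed
  have M_mult: "u * v \<in> M" and M_divide: "u / v \<in> M" if "u \<in> M" "v \<in> M" for u v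
    using that by (simp_all only: M_def mem_Collect_eq power_mult_distrib power_divide div_by_1 mult_1_left)
  have finite_M: "finite M"
    by simp
  show ?thesis
  proof (rule not_covered_by_sets[OF finite_M card_M card])
    fix u assume u: "u \<in> M"
    \<comment> \<open>For fixed \<open>u\<close> the condition is a polynomial equation of degree
      \<open>r\<close> in \<open>c\<close>.\<close>
    define p where "p = Polynomial.monom u r + Polynomial.monom (u ^ s) 1 + [:u ^ (s + 1) + 1:]"
    have "r \<ge> 4"
      using t by simp
    then have "Polynomial.coeff p r \<noteq> 0"
      using unity(1)[OF u] by (simp add: p_def coeff_pCons split: nat.split)
    moreover have "poly p c = 0" if "c \<in> L u" for c
      using that by (simp add: p_def L_def poly_monom algebra_simps)
    moreover have "Polynomial.degree p \<le> r"
      unfolding p_def using \<open>r \<ge> 4\<close>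
      by (intro degree_add_le order_trans[OF degree_monom_le]) simp_all
    ultimately show "card (L u) \<le> r"
      using card_zeros_le by blast
  next
    fix c :: 'a
    \<comment> \<open>For fixed \<open>c\<close> the condition becomes polynomial in
      \<open>u\<close> of low degree: \<open>u ^ s\<close> is replaced by \<open>u ^ t\<close>, or,
      if these are inverse to each other, the equation is multiplied by \<open>u ^ t\<close>. In the
      second case the top coefficient \<open>c ^ r\<close> may vanish, so the coefficient at
      \<open>t\<close> shows that \<open>p\<close> is nonzero.\<close>
    define p where "p = (if even (n div m)
      then Polynomial.monom 1 (t + 1) + Polynomial.monom c t + Polynomial.monom (c ^ r) 1 + 1
      else Polynomial.monom 1 1 + [:c:] + Polynomial.monom (c ^ r) (t + 1) + Polynomial.monom 1 t)"
    have "Polynomial.coeff p (if even (n div m) then t + 1 else t) \<noteq> 0"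
      using t by (auto simp: p_def coeff_pCons split: nat.split)
    moreover have "poly p u = 0" if "u \<in> {u \<in> M. c \<in> L u}" for u
    proof -
      have eq: "u ^ s * u + c * u ^ s + c ^ r * u + 1 = 0" and "u \<in> M"
        using that by (simp_all add: L_def mult.commute)
      show ?thesis
      proof (cases "even (n div m)")
        case True
        then show ?thesis
          using pow_s[OF \<open>u \<in> M\<close>] eq by (simp add: p_def poly_monom mult.commute)
      next
        case False
        then have inv: "u ^ t * u ^ s = 1"
          using pow_s[OF \<open>u \<in> M\<close>] by simp
        have "u ^ t * (u ^ s * u + c * u ^ s + c ^ r * u + 1)
            = (u ^ t * u ^ s) * u + c * (u ^ t * u ^ s) + c ^ r * (u * u ^ t) + u ^ t"
          by (simp add: algebra_simps)
        then show ?thesis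
          using False eq inv by (simp add: p_def poly_monom)
      qed
    qed
    moreover have "Polynomial.degree p \<le> t + 1"
      unfolding p_def using t
      by (auto intro!: degree_add_le order_trans[OF degree_monom_le])
    ultimately have "card {u \<in> M. c \<in> L u} \<le> t + 1"
      using card_zeros_le by blast
    then show "2 * card {u \<in> M. c \<in> L u} \<le> r + 2"
      using t by simp
  next
    fix u assume u: "u \<in> M"
    \<comment> \<open>\<open>H\<close> is a subgroup of \<open>M\<close>, and
      \<open>u ^ s * v + v ^ s * u\<close> vanishes only for \<open>v\<close> in the coset of
      \<open>u\<close>. The aim is that \<open>H\<close> fills at most half of
      \<open>M\<close>.\<close>
    define H where "H = {v \<in> M. v ^ s = v}"
    \<comment> \<open>Otherwise all \<open>r + 1\<close> elements \<open>v\<close> of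
      \<open>M\<close> would satisfy \<open>v ^ t = v\<close>, or all would satisfy
      \<open>v ^ (t + 1) = 1\<close>: too many roots, since \<open>t < r\<close>.\<close>
    have "\<not> M \<subseteq> H"
    proof
      assume "M \<subseteq> H"
      define p :: "'a poly" where "p = (if even (n div m)
        then Polynomial.monom 1 t - Polynomial.monom 1 1 else Polynomial.monom 1 (t + 1) - 1)"
      have "Polynomial.coeff p (if even (n div m) then t else t + 1) \<noteq> 0"
        using t by (simp add: p_def)
      moreover have "poly p v = 0" if "v \<in> M" for v
        using \<open>M \<subseteq> H\<close> that pow_s[OF that] by (auto simp: H_def p_def poly_monom mult.commute split: if_splits)
      moreover have "Polynomial.degree p \<le> t + 1"
        unfolding p_def using t
        by (auto intro!: degree_diff_le order_trans[OF degree_monom_le])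
      ultimately have "card M \<le> t + 1"
        using card_zeros_le by blast
      then show False
        using t card_M by simp
    qed
    then obtain w where w: "w \<in> M" "w ^ s \<noteq> w"
      by (auto simp: H_def)
    \<comment> \<open>The translate of \<open>H\<close> by \<open>w\<close> lies in \<open>M\<close>
      and is disjoint from \<open>H\<close>.\<close>
    have "card H + card ((*) w ` H) = card (H \<union> (*) w ` H)"
      using w unity(1)[of w] by (intro card_Un_disjoint[symmetric]) (auto simp: H_def power_mult_distrib dest: unity(1))
    also have "\<dots> \<le> card M"
      using w(1) by (intro card_mono) (auto simp: H_def M_mult)
    also have "card ((*) w ` H) = card H"
      using unity(1)[OF w(1)] by (intro card_image) (auto simp: inj_on_def)
    finally have "2 * card H \<le> r + 1"
      using card_M by simp
    have "{v \<in> M. u ^ s * v + v ^ s * u = 0} \<subseteq> (*) u ` H"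
    proof
      fix v assume v: "v \<in> {v \<in> M. u ^ s * v + v ^ s * u = 0}"
      then have "u ^ s * v = v ^ s * u"
        by (simp add: add_eq_0_iff_CHAR_2[OF char])
      then have "v / u \<in> H"
        using v u unity(1)[OF u] by (auto simp: H_def M_divide power_divide field_simps)
      then show "v \<in> (*) u ` H"
        using unity(1)[OF u] by (intro image_eqI[of _ _ "v / u"]) simp_all
    qed
    then have "card {v \<in> M. u ^ s * v + v ^ s * u = 0} \<le> card H"
      by (intro surj_card_le) simp_all
    moreover have "card M = card {v \<in> M. u ^ s * v + v ^ s * u = 0}
        + card {v \<in> M. u ^ s * v + v ^ s * u \<noteq> 0}"
      by (subst card_Un_disjoint[symmetric]) (auto intro!: arg_cong[where f = card])
    moreover have "{v \<in> M. u ^ s * v + v ^ s * u \<noteq> 0} \<subseteq> {v \<in> M. v \<noteq> u \<and> L u \<inter> L v \<noteq> {}}"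
    proof safe
      assume "u ^ s * u + u ^ s * u \<noteq> 0"
      then show False
        by (simp add: two)
    next
      fix v assume v: "v \<in> M" and D: "u ^ s * v + v ^ s * u \<noteq> 0" and empty: "L u \<inter> L v = {}"
      \<comment> \<open>Cramer's rule: \<open>D\<close> is the determinant of the system
        \<open>c * u ^ s + e * u = a\<close>, \<open>c * v ^ s + e * v = b\<close> in the unknowns
        \<open>c\<close> and \<open>e\<close>. A common point of \<open>L u\<close> and
        \<open>L v\<close> arises if the solution satisfies \<open>e = c ^ r\<close>.\<close>
      define D where "D = u ^ s * v + v ^ s * u"
      define a where "a = 1 + u ^ s * u"
      define b where "b = 1 + v ^ s * v"
      have pows: "(u ^ s) ^ r = inverse (u ^ s)" "(v ^ s) ^ r = inverse (v ^ s)"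
        using unity(2)[OF u] unity(2)[OF v] by (metis power_commutes power_inverse power_mult mult.commute)+
      \<comment> \<open>The \<open>r\<close>-th power inverts elements of \<open>M\<close>, and the
        factor \<open>E\<close> clears the resulting denominators. It cancels in the quotient, which
        identifies \<open>c ^ r\<close> with the second Cramer value.\<close>
      define E where "E = u ^ s * u * (v ^ s * v)"
      have nz: "u \<noteq> 0" "v \<noteq> 0" "D \<noteq> 0" "E \<noteq> 0"
        using unity(1) u v D by (auto simp: D_def E_def)
      define c where "c = (a * v + b * u) / D"
      have "E * D ^ r = D"
        using nz by (simp add: D_def E_def addr power_mult_distrib pows unity(2) u v field_simps)
      moreover have "E * (a * v + b * u) ^ r = a * v ^ s + b * u ^ s"
        using nz by (simp add: a_def b_def E_def addr power_mult_distrib pows unity(2) u v field_simps)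
      ultimately have cr: "c ^ r = (a * v ^ s + b * u ^ s) / D"
        using nz by (metis c_def mult_divide_mult_cancel_left power_divide)
      have "(a * v + b * u) * u ^ s + (a * v ^ s + b * u ^ s) * u = a * D"
        and "(a * v + b * u) * v ^ s + (a * v ^ s + b * u ^ s) * v = b * D"
        by (simp_all add: D_def algebra_simps two)
      then have "c * u ^ s + c ^ r * u = a" "c * v ^ s + c ^ r * v = b"
        using nz unfolding cr by (simp_all add: c_def divide_simps)
      moreover have "u ^ (s + 1) + c * u ^ s + c ^ r * u + 1 = a + (c * u ^ s + c ^ r * u)"
        and "v ^ (s + 1) + c * v ^ s + c ^ r * v + 1 = b + (c * v ^ s + c ^ r * v)"
        by (simp_all add: a_def b_def algebra_simps)
      ultimately have "c \<in> L u \<inter> L v"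
        by (simp add: L_def two)
      then show False
        using empty by auto
    qed
    then have "card {v \<in> M. u ^ s * v + v ^ s * u \<noteq> 0} \<le> card {v \<in> M. v \<noteq> u \<and> L u \<inter> L v \<noteq> {}}"
      by (intro card_mono) auto
    ultimately show "2 * card {v \<in> M. v \<noteq> u \<and> L u \<inter> L v \<noteq> {}} \<ge> r + 1"
      using \<open>2 * card H \<le> r + 1\<close> card_M by linarith
  next
    fix c assume "\<And>u. u \<in> M \<Longrightarrow> c \<notin> L u"
    then show ?thesis
      by (intro that[of c]) (auto simp: M_def L_def)
  qed
qed

section \<open>The derivatives of \<open>F\<close> and their kernels\<close>

lemma F_eq:
  "F r s c d x = x * x ^ s + x * x ^ r + c * x * (x ^ r) ^ s + c ^ r * x ^ r * x ^ s
    + d * x ^ s * (x ^ r) ^ s + x ^ r * (x ^ r) ^ s"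
proof -
  have "x ^ ((s + 1) * r) = x ^ r * (x ^ r) ^ s"
    by (simp add: power_add mult.commute flip: power_mult)
  moreover have "x ^ (r * s) = (x ^ r) ^ s"
    by (rule power_mult)
  ultimately show ?thesis
    by (simp add: F_def algebra_simps)
qed

text \<open>The left side is \<open>(G + P) + d * P ^ s\<close> with \<open>G\<close> and
  \<open>P\<close> in the subfield and \<open>d\<close> outside it, so both coordinates vanish. The
  alternatives in \<open>nonzero\<close> serve the cases \<open>m dvd n\<close> and
  \<open>\<not> m dvd n\<close>.\<close>

lemma F_derivative_kernel:
  fixes c d a z :: "'a::finite_field" and m n r s :: nat
  assumes r_def: "r = 2 ^ m" and s_def: "s = 2 ^ n" and card: "CARD('a) = r ^ 2"
    and "a \<noteq> 0" and d: "d ^ r \<noteq> d"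
    and nonzero: "(\<forall>t::'a. t ^ r = t \<longrightarrow> t ^ s = t) \<or>
      (\<forall>u. u ^ (r + 1) = 1 \<longrightarrow> u ^ (s + 1) + c * u ^ s + c ^ r * u + 1 \<noteq> 0)"
  shows "F r s c d (z + a) + F r s c d z + F r s c d a = 0 \<longleftrightarrow> (z / a) ^ r = z / a \<and> (z / a) ^ s = z / a"
proof -
  have char: "CHAR('a) = 2"
    by (rule CHAR_eq_2I[of "m * 2"]) (simp add: card r_def power_mult)
  note two = add_self_CHAR_2[OF char]
  have addr: "(x + y) ^ r = x ^ r + y ^ r" and adds: "(x + y) ^ s = x ^ s + y ^ s" for x y :: 'a
    unfolding r_def s_def by (rule power_two_power_add[OF char])+
  have rr: "(x ^ r) ^ r = x" for x :: 'a
    using finite_field_power_card_eq_same[of x] by (simp add: card power2_eq_square flip: power_mult)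
  have sr: "(x ^ s) ^ r = (x ^ r) ^ s" for x :: 'a
    by (simp add: mult.commute flip: power_mult)
  define t where "t = z / a"
  have z: "z = a * t"
    using \<open>a \<noteq> 0\<close> by (simp add: t_def)
  \<comment> \<open>\<open>P\<close> and \<open>G\<close> are the polar forms at \<open>a\<close> of
    the norm and of the trace form, evaluated at \<open>z = a * t\<close>.\<close>
  define P where "P = a * a ^ r * (t + t ^ r)"
  define G where "G = a * a ^ s * (t + t ^ s) + a ^ r * (a ^ r) ^ s * (t ^ r + (t ^ r) ^ s)
    + c * a * (a ^ r) ^ s * (t + (t ^ r) ^ s) + c ^ r * a ^ r * a ^ s * (t ^ r + t ^ s)"
  have D: "F r s c d (z + a) + F r s c d z + F r s c d a = (G + P) + d * P ^ s"
    by (simp add: F_eq z G_def P_def addr adds power_mult_distrib algebra_simps two)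
  have P_r: "P ^ r = P"
    by (simp add: P_def addr power_mult_distrib rr algebra_simps)
  have G_r: "G ^ r = G"
    by (simp add: G_def addr power_mult_distrib rr sr algebra_simps)
  have "G + P + d * P ^ s = 0 \<longleftrightarrow> t ^ r = t \<and> t ^ s = t"
  proof safe
    assume eq: "G + P + d * P ^ s = 0"
    have "P = 0"
    proof (rule ccontr)
      assume "P \<noteq> 0"
      have "d * P ^ s = G + P"
        using eq add_eq_0_iff_CHAR_2[OF char] by simp
      then have "d = (G + P) / P ^ s"
        using \<open>P \<noteq> 0\<close> by (simp add: field_simps)
      then have "d ^ r = d"
        by (simp add: power_divide addr P_r G_r sr)
      with d show False
        by simp
    qed
    then show t: "t ^ r = t"
      using \<open>a \<noteq> 0\<close> by (simp add: P_def add_eq_0_iff_CHAR_2[OF char])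
    have "G = 0"
      using eq \<open>P = 0\<close> by (simp add: s_def power_0_left)
    define u where "u = a ^ r / a"
    have "u ^ (r + 1) = 1"
      using \<open>a \<noteq> 0\<close> by (simp add: u_def power_divide rr)
    \<comment> \<open>Since \<open>t ^ r = t\<close>, all four brackets in \<open>G\<close> collapse
      to \<open>t + t ^ s\<close>.\<close>
    have "G = a * a ^ s * (u ^ (s + 1) + c * u ^ s + c ^ r * u + 1) * (t + t ^ s)"
      using \<open>a \<noteq> 0\<close> by (simp add: G_def t u_def power_divide field_simps)
    then show "t ^ s = t"
      using \<open>G = 0\<close> nonzero t \<open>u ^ (r + 1) = 1\<close> \<open>a \<noteq> 0\<close>
      by (auto simp: add_eq_0_iff_CHAR_2[OF char])
  next
    assume "t ^ r = t" "t ^ s = t"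
    then show "G + P + d * P ^ s = 0"
      by (simp add: G_def P_def two s_def power_0_left)
  qed
  then show ?thesis
    by (simp add: D t_def)
qed

text \<open>Every term of \<open>F\<close> is a product of two additive maps, up to a constant
  factor, so its polar form is additive. Fibres of derivatives are therefore cosets of the
  kernel.\<close>

lemma F_linear_part_add:
  fixes c d a :: "'a::finite_field" and m n :: nat
  assumes char: "CHAR('a) = 2" and r_def: "r = 2 ^ m" and s_def: "s = 2 ^ n"
  defines "D \<equiv> \<lambda>x. F r s c d (x + a) + F r s c d x + F r s c d a"
  shows "D (x + y) = D x + D y"
proof -
  note two = add_self_CHAR_2[OF char]
  have addr: "(x + y) ^ r = x ^ r + y ^ r" and adds: "(x + y) ^ s = x ^ s + y ^ s" for x y :: 'a
    unfolding r_def s_def by (rule power_two_power_add[OF char])+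
  show ?thesis
    by (simp add: D_def F_eq addr adds algebra_simps two)
qed

section \<open>Fibres of the derivatives as cosets of the kernel\<close>

theorem theorem3:
  fixes m n k r s :: nat
    and K :: "'a::finite_field set"
  assumes "m \<ge> 1" and "n \<ge> 1"
    and "r = 2 ^ m" and "s = 2 ^ n" and "k = gcd m n"
    and "CARD('a) = r ^ 2"
    and "subfield K (ring_of_type_algebra :: 'a ring)" and "card K = r"
  shows "\<forall>d. d \<notin> K \<longrightarrow>
           (\<exists>c. \<forall>a. a \<noteq> 0 \<longrightarrow> N_to_one (2 ^ k) (derivative_at (F r s c d) a))"
proof (intro allI impI)
  fix d :: 'a
  assume "d \<notin> K"
  then have d: "d ^ r \<noteq> d"
    using subfield_eq_power_card_fixed[OF assms(7)] assms(8) by auto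
  have card: "CARD('a) = 2 ^ (m * 2)"
    by (simp add: assms(3,6) power_mult)
  have char: "CHAR('a) = 2"
    by (rule CHAR_eq_2I[OF card])
  note two = add_self_CHAR_2[OF char]
  obtain c :: 'a where c: "(\<forall>t::'a. t ^ r = t \<longrightarrow> t ^ s = t) \<or>
      (\<forall>u. u ^ (r + 1) = 1 \<longrightarrow> u ^ (s + 1) + c * u ^ s + c ^ r * u + 1 \<noteq> 0)"
  proof (cases "m dvd n")
    case True
    \<comment> \<open>Here \<open>s\<close> is a power of \<open>r\<close>, so every
      \<open>c\<close> meets the first alternative.\<close>
    then have "t ^ s = t" if "t ^ r = t" for t :: 'a
      using power_power_fixed[OF that] by (auto simp: assms(3,4) power_mult)
    then show ?thesis
      using that by blast
  next
    case False
    with ex_no_unity_root[OF assms(3,4,6)] that show ?thesis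
      by metis
  qed
  define Fix where "Fix = {t::'a. t ^ r = t \<and> t ^ s = t}"
  have "Fix = {t. t ^ 2 ^ k = t}"
    unfolding Fix_def assms(3-5) by (intro Collect_cong power_two_power_fixed_gcd) (use assms(1) in simp)
  then have card_Fix: "card Fix = 2 ^ k"
    using card_power_two_power_fixed[OF card, of k] assms(1) unfolding assms(5) by simp
  have "N_to_one (2 ^ k) (derivative_at (F r s c d) a)" if "a \<noteq> 0" for a
    unfolding N_to_one_def
  proof (intro allI disj_imp[THEN iffD2] impI)
    fix b
    assume "{x. derivative_at (F r s c d) a x = b} \<noteq> {}"
    then obtain y where y: "derivative_at (F r s c d) a y = b"
      by auto
    define D where "D x = F r s c d (x + a) + F r s c d x + F r s c d a" for x
    have D_add: "D (x + y) = D x + D y" for x y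
      unfolding D_def by (rule F_linear_part_add[OF char assms(3,4)])
    have "derivative_at (F r s c d) a x = b \<longleftrightarrow> (x + y) / a \<in> Fix" for x
    proof -
      have "derivative_at (F r s c d) a x = b \<longleftrightarrow> D x = D y"
        by (simp add: y[symmetric] D_def derivative_at_def)
      also have "\<dots> \<longleftrightarrow> D (x + y) = 0"
        by (simp add: D_add add_eq_0_iff_CHAR_2[OF char])
      also have "\<dots> \<longleftrightarrow> (x + y) / a \<in> Fix"
        unfolding D_def Fix_def mem_Collect_eq
        by (rule F_derivative_kernel[OF assms(3,4,6) that d c])
      finally show ?thesis .
    qed
    \<comment> \<open>The fibre is the coset of \<open>y\<close> modulo \<open>a\<close> times
      \<open>Fix\<close>; the inverse map adds \<open>y\<close> because
      \<open>y + y = 0\<close>.\<close>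
    then have "bij_betw (\<lambda>t. a * t + y) Fix {x. derivative_at (F r s c d) a x = b}"
      using that by (intro bij_betwI[of _ _ _ "\<lambda>x. (x + y) / a"]) (auto simp: add.assoc two)
    then show "finite {x. derivative_at (F r s c d) a x = b} \<and>
        card {x. derivative_at (F r s c d) a x = b} = 2 ^ k"
      using card_Fix by (auto dest: bij_betw_same_card)
  qed
  then show "\<exists>c. \<forall>a. a \<noteq> 0 \<longrightarrow> N_to_one (2 ^ k) (derivative_at (F r s c d) a)"
    by blast
qed

end
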